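(* Let $\tau$ be an uncountable cardinal and let $G$ be a pseudocompact topological group. If $G$ is not metrizable, then $G$ is not pseudo-$\tau$-fine.
   Context: All topological groups are Hausdorff. A topological space is pseudocompact if every continuous real-valued function on it has bounded range; a pseudocompact group is a topological group whose underlying space is pseudocompact. For an infinite cardinal $\tau$, a topological group $G$ is pseudo-$\tau$-fine if for every family $\{U_\alpha:\alpha\in\tau\}$ of identity neighbourhoods there is a countable family $\{V_n:n\in\omega\}$ of identity neighbourhoods with $\bigcap_{n\in\omega}V_n\subseteq\bigcap_{\alpha\in\tau}U_\alpha$. *)

theory Defs
  imports "HOL-Analysis.Analysis"
begin

definition pseudocompact_space :: "'a topology \<Rightarrow> bool" where
  "pseudocompact_space X \<longleftrightarrow>
     (\<forall>f. continuous_map X euclideanreal f \<longrightarrow> bounded (f ` topspace X))"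

(* The group is the type 'a, written additively but not assumed commutative, with identity 0.
   The cardinal \<tau> is a cardinal order, so "\<alpha> \<in> \<tau>" becomes "\<alpha> \<in> Field \<tau>".
   Neighbourhoods need not be open. *)
definition pseudo_fine :: "'i rel \<Rightarrow> 'a::topological_group_add itself \<Rightarrow> bool" where
  "pseudo_fine \<tau> (_ :: 'a itself) \<longleftrightarrow>
     (\<forall>U :: 'i \<Rightarrow> 'a set. (\<forall>\<alpha>\<in>Field \<tau>. 0 \<in> interior (U \<alpha>)) \<longrightarrow>
       (\<exists>V :: nat \<Rightarrow> 'a set. (\<forall>n. 0 \<in> interior (V n)) \<and>
          (\<Inter>n. V n) \<subseteq> (\<Inter>\<alpha>\<in>Field \<tau>. U \<alpha>)))"

end

theory Submission
  imports Defs "HOL-Library.Countable_Set_Type"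
begin

text \<open>A continuous pseudonorm \<open>N\<close> gives the left-invariant pseudometric \<open>N (- x + y)\<close>. In a
  pseudocompact group every such pseudometric is totally bounded, and if the zero set of \<open>N\<close> lies in
  that of \<open>M\<close> then \<open>M\<close> is continuous for the pseudometric of \<open>N\<close>. Hence, when the group is not
  metrizable, no countable family of pseudonorms has common zero set \<open>{0}\<close>, and transfinite recursion
  gives \<open>\<aleph>\<^sub>1\<close> pseudonorms whose common zero sets strictly decrease. If the group were
  pseudo-\<open>\<tau>\<close>-fine, the zero set of a single \<open>N\<close> would lie in all of these zero sets, so the separable
  pseudometric of \<open>N\<close> would have a strictly decreasing \<open>\<omega>\<^sub>1\<close>-sequence of closed sets.\<close>

section \<open>Continuous pseudonorms\<close>

text \<open>Nonnegativity is a consequence: \<open>0 = N (x + - x) \<le> 2 * N x\<close>.\<close>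

definition cont_pseudonorm :: "('a::topological_group_add \<Rightarrow> real) \<Rightarrow> bool" where
  "cont_pseudonorm N \<longleftrightarrow> N 0 = 0 \<and> (\<forall>x. N (- x) = N x) \<and>
     (\<forall>x y. N (x + y) \<le> N x + N y) \<and> continuous_on UNIV N"

lemma cont_pseudonormD:
  assumes "cont_pseudonorm N"
  shows "N 0 = 0" "N (- x) = N x" "N (x + y) \<le> N x + N y" "continuous_on UNIV N" "0 \<le> N x"
proof -
  show "N 0 = 0" "N (- x) = N x" "N (x + y) \<le> N x + N y" "continuous_on UNIV N"
    using assms by (auto simp: cont_pseudonorm_def)
  have "N (x + - x) \<le> N x + N (- x)"
    using assms unfolding cont_pseudonorm_def by blast
  then show "0 \<le> N x"
    using assms by (simp add: cont_pseudonorm_def)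
qed

lemma cont_pseudonorm_triangle:
  assumes "cont_pseudonorm N"
  shows "N (- x + z) \<le> N (- x + y) + N (- y + z)"
  using cont_pseudonormD(3)[OF assms, of "- x + y" "- y + z"] by (simp add: add.assoc)

lemma cont_pseudonorm_commute:
  assumes "cont_pseudonorm N"
  shows "N (- x + y) = N (- y + x)"
  using cont_pseudonormD(2)[OF assms, of "- x + y"] by (simp add: minus_add)

lemma cont_pseudonorm_le_add:
  assumes "cont_pseudonorm N"
  shows "N y \<le> N x + N (- x + y)"
  using cont_pseudonormD(3)[OF assms, of x "- x + y"] by (simp add: add.assoc[symmetric])

lemma continuous_on_pseudonorm_diff:
  assumes "cont_pseudonorm N"
  shows "continuous_on UNIV (\<lambda>x. N (- a + x))"
  by (rule continuous_on_compose2[OF cont_pseudonormD(4)[OF assms]])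
     (auto intro!: continuous_intros)

lemma open_pseudonorm_ball:
  assumes "cont_pseudonorm N"
  shows "open {x. N (- a + x) < e}"
  by (intro open_Collect_less continuous_on_pseudonorm_diff[OF assms] continuous_on_const)

lemma open_pseudonorm_less:
  assumes "cont_pseudonorm N"
  shows "open {x. N x < e}"
  using open_pseudonorm_ball[OF assms, of 0 e] by simp

lemma open_pseudonorm_greater:
  assumes "cont_pseudonorm N"
  shows "open {x. e < N x}"
  by (intro open_Collect_less cont_pseudonormD(4)[OF assms] continuous_on_const)

section \<open>Pseudonorms from neighbourhoods of the identity\<close>

text \<open>Continuity of \<open>x + y + z\<close> at the origin gives a box of three
  neighbourhoods; their intersection is then made symmetric.\<close>

lemma open_triple_sum_nhd:
  fixes A :: "'a::topological_group_add set"
  assumes "open A" "0 \<in> A"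
  obtains W where "open W" "0 \<in> W" "\<And>x. x \<in> W \<Longrightarrow> - x \<in> W"
    "\<And>x y z. x \<in> W \<Longrightarrow> y \<in> W \<Longrightarrow> z \<in> W \<Longrightarrow> x + y + z \<in> A"
proof -
  let ?f = "\<lambda>p :: 'a \<times> 'a \<times> 'a. fst p + fst (snd p) + snd (snd p)"
  have "continuous_on UNIV ?f"
    by (intro continuous_intros)
  then have "open (?f -` A)"
    by (rule open_vimage[OF assms(1)])
  moreover have "(0, 0, 0) \<in> ?f -` A"
    using assms by simp
  ultimately obtain B C where B: "open B" "0 \<in> B" and C: "open C" "(0, 0) \<in> C"
    and BC: "B \<times> C \<subseteq> ?f -` A"
    by (rule open_prod_elim) simp
  obtain D E where D: "open D" "0 \<in> D" and E: "open E" "0 \<in> E" and DE: "D \<times> E \<subseteq> C"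
    by (rule open_prod_elim[OF C]) simp
  define W where "W = B \<inter> D \<inter> E \<inter> uminus -` (B \<inter> D \<inter> E)"
  show ?thesis
  proof
    show "open W"
      unfolding W_def using B(1) D(1) E(1)
      by (intro open_Int open_vimage continuous_on_minus continuous_on_id)
    show "0 \<in> W"
      using B D E by (simp add: W_def)
    show "- x \<in> W" if "x \<in> W" for x
      using that by (simp add: W_def)
    show "x + y + z \<in> A" if "x \<in> W" "y \<in> W" "z \<in> W" for x y z
    proof -
      have "(x, y, z) \<in> B \<times> C"
        using that DE by (auto simp: W_def)
      then show ?thesis
        using BC by auto
    qed
  qed
qed

text \<open>The entry \<open>x\<close> is the one at which the running sum first exceeds
  \<open>c\<close>. Passing an entry \<open>a\<close> lowers the threshold to
  \<open>c - f a\<close>, which is still nonnegative.\<close>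

lemma split_list_at_partial_sum:
  fixes f :: "'b \<Rightarrow> real"
  assumes "0 \<le> c" "c < sum_list (map f xs)"
  obtains ys x zs where "xs = ys @ x # zs" "sum_list (map f ys) \<le> c"
    "c < sum_list (map f ys) + f x"
proof -
  have "\<exists>ys x zs. xs = ys @ x # zs \<and> sum_list (map f ys) \<le> c \<and> c < sum_list (map f ys) + f x"
    using assms
  proof (induction xs arbitrary: c)
    case (Cons a xs)
    show ?case
    proof (cases "c < f a")
      case True
      then show ?thesis
        using Cons.prems by (intro exI[of _ "[]"]) auto
    next
      case False
      then obtain ys x zs where "xs = ys @ x # zs" "sum_list (map f ys) \<le> c - f a"
        "c - f a < sum_list (map f ys) + f x"
        using Cons.IH[of "c - f a"] Cons.prems by auto
      then show ?thesis
        by (intro exI[of _ "a # ys"] exI[of _ x] exI[of _ zs]) auto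
    qed
  qed simp
  then show thesis
    using that by blast
qed

text \<open>Cutting the list at half its total weight leaves one entry and two lists of at most half the
  weight, which is why three summands from \<open>W (Suc n)\<close> must fit into \<open>W n\<close>.\<close>
lemma sum_list_mem_of_weight_less:
  fixes W :: "nat \<Rightarrow> 'a::group_add set"
  assumes zero: "\<And>n. 0 \<in> W n"
    and triple: "\<And>n x y z. x \<in> W (Suc n) \<Longrightarrow> y \<in> W (Suc n) \<Longrightarrow> z \<in> W (Suc n) \<Longrightarrow> x + y + z \<in> W n"
    and "\<forall>p\<in>set xs. snd p \<in> W (fst p)"
    and "(\<Sum>p\<leftarrow>xs. (1/2) ^ fst p) < (1/2 :: real) ^ n"
  shows "(\<Sum>p\<leftarrow>xs. snd p) \<in> W n"
  using assms(3,4)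
proof (induction "length xs" arbitrary: xs n rule: less_induct)
  case less
  let ?w = "\<lambda>p :: nat \<times> 'a. (1/2 :: real) ^ fst p"
  let ?s = "\<lambda>xs. sum_list (map ?w xs)"
  have W_mono: "W m \<subseteq> W k" if "k \<le> m" for k m
    using that
  proof (rule lift_Suc_antimono_le[of W, rotated])
    show "W (Suc n) \<subseteq> W n" for n
      using triple[of _ n 0 0] zero by auto
  qed
  have nonneg: "0 \<le> ?s ys" for ys
    by (rule sum_list_nonneg) auto
  show ?case
  proof (cases "xs = []")
    case True
    then show ?thesis
      using zero by simp
  next
    case False
    then have "0 < ?s xs"
      using nonneg[of "tl xs"] by (cases xs) (auto simp: add_pos_nonneg)
    then obtain ys p zs where xs: "xs = ys @ p # zs" and ys: "?s ys \<le> ?s xs / 2"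
      and p: "?s xs / 2 < ?s ys + ?w p"
      using split_list_at_partial_sum[of "?s xs / 2" ?w xs]
      by (metis field_sum_of_halves half_gt_zero less_add_same_cancel1 less_le)
    have half: "?s xs / 2 < (1/2) ^ Suc n"
      using less.prems by simp
    have sum: "?s xs = ?s ys + ?w p + ?s zs"
      by (simp add: xs)
    have "(\<Sum>p\<leftarrow>ys. snd p) \<in> W (Suc n)"
      using less.prems xs ys half by (intro less.hyps) auto
    moreover have "(\<Sum>p\<leftarrow>zs. snd p) \<in> W (Suc n)"
      using less.prems xs p half sum by (intro less.hyps) auto
    \<comment> \<open>The middle entry may carry more than half the weight, but its weight is a
      power of 1/2 below \<open>(1/2) ^ n\<close>, so its index is at least
      \<open>Suc n\<close>.\<close>
    moreover have "?w p < (1/2) ^ n"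
      using less.prems(2) sum nonneg[of ys] nonneg[of zs] by linarith
    then have "n < fst p"
      using power_strict_decreasing_iff[of "1/2 :: real" "fst p" n] by simp
    then have "snd p \<in> W (Suc n)"
      using less.prems xs W_mono[of "Suc n" "fst p"] by auto
    ultimately show ?thesis
      using triple by (simp add: xs add.assoc)
  qed
qed

text \<open>The Birkhoff--Kakutani construction: \<open>N x\<close> is the infimum of the weights of representations of \<open>x\<close>
  as a sum of elements of the \<open>W n\<close>, those of \<open>W n\<close> having weight \<open>2\<^sup>-\<^sup>n\<close>.\<close>
lemma cont_pseudonorm_exists:
  fixes V :: "nat \<Rightarrow> 'a::topological_group_add set"
  assumes "\<And>n. 0 \<in> interior (V n)"
  obtains N where "cont_pseudonorm N" "\<And>n. \<exists>e>0. {x. N x < e} \<subseteq> V n"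
proof -
  let ?Q = "\<lambda>A. open A \<and> 0 \<in> A \<and> (\<forall>x\<in>A. - x \<in> A)"
  let ?R = "\<lambda>n A B. \<forall>x\<in>B. \<forall>y\<in>B. \<forall>z\<in>B. x + y + z \<in> A \<inter> V n"
  have "\<exists>W. \<forall>n. ?Q (W n) \<and> ?R n (W n) (W (Suc n))"
  proof (rule dependent_nat_choice)
    show "\<exists>A :: 'a set. ?Q A"
      by (rule exI[of _ UNIV]) simp
    fix A :: "'a set" and n
    assume A: "?Q A"
    have "open (A \<inter> interior (V n))" "0 \<in> A \<inter> interior (V n)"
      using A assms by auto
    from open_triple_sum_nhd[OF this] obtain B where "open B" "0 \<in> B" "\<And>x. x \<in> B \<Longrightarrow> - x \<in> B"
      "\<And>x y z. x \<in> B \<Longrightarrow> y \<in> B \<Longrightarrow> z \<in> B \<Longrightarrow> x + y + z \<in> A \<inter> interior (V n)"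
      by metis
    then show "\<exists>B. ?Q B \<and> ?R n A B"
      using interior_subset[of "V n"] by (intro exI[of _ B]) blast
  qed
  then obtain W0 where "\<forall>n. ?Q (W0 n) \<and> ?R n (W0 n) (W0 (Suc n))"
    by (rule exE)
  then have W0: "?Q (W0 n)" "?R n (W0 n) (W0 (Suc n))" for n
    by simp_all
  \<comment> \<open>Level 0 is the whole group, so every \<open>x\<close> has the one-term
    representation \<open>[(0, x)]\<close> and the infimum runs over a nonempty set.\<close>
  define W where "W n = (case n of 0 \<Rightarrow> UNIV | Suc m \<Rightarrow> W0 m)" for n
  have open_W: "open (W n)" and zero: "0 \<in> W n" and minus: "x \<in> W n \<Longrightarrow> - x \<in> W n" for n x
    using W0(1) by (auto simp: W_def split: nat.split)
  have triple: "x + y + z \<in> W n" if "x \<in> W (Suc n)" "y \<in> W (Suc n)" "z \<in> W (Suc n)" for n x y z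
    using W0(2) that by (cases n) (auto simp: W_def)
  have W_V: "W (Suc (Suc n)) \<subseteq> V n" for n
    using W0(2)[of n] W0(1)[of "Suc n"] by (force simp: W_def)
  define P where "P x = {xs. (\<forall>p\<in>set xs. snd p \<in> W (fst p)) \<and> (\<Sum>p\<leftarrow>xs. snd p) = x}"
    for x
  define w where "w xs = (\<Sum>p\<leftarrow>xs. (1/2 :: real) ^ fst p)" for xs :: "(nat \<times> 'a) list"
  define N where "N x = Inf (w ` P x)" for x
  have w_nonneg: "0 \<le> w xs" for xs
    unfolding w_def by (rule sum_list_nonneg) auto
  have bdd: "bdd_below (w ` P x)" for x
    using w_nonneg by (auto intro!: bdd_belowI[of _ 0])
  have N_le: "N x \<le> w xs" if "xs \<in> P x" for x xs
    unfolding N_def using that bdd by (intro cInf_lower) auto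
  have nonempty: "P x \<noteq> {}" for x
  proof -
    have "[(0, x)] \<in> P x"
      by (simp add: P_def W_def)
    then show ?thesis
      by blast
  qed
  have approx: "\<exists>xs\<in>P x. w xs < c" if "N x < c" for x c
    using cInf_lessD[of "w ` P x" c] nonempty that by (auto simp: N_def)
  have N_nonneg: "0 \<le> N x" for x
    unfolding N_def using w_nonneg nonempty by (intro cInf_greatest) auto
  \<comment> \<open>Some representation of \<open>x\<close> weighs less than
    \<open>(1/2) ^ n\<close>, and the weight lemma puts its sum into \<open>W n\<close>.\<close>
  have mem_W: "x \<in> W n" if "N x < (1/2) ^ n" for x n
    using approx[OF that] sum_list_mem_of_weight_less[of W, OF zero triple]
    by (auto simp: P_def w_def)
  have N_zero: "N 0 = 0"
    using N_le[of "[]" 0] N_nonneg[of 0] by (simp add: P_def w_def)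
  have N_add: "N (x + y) \<le> N x + N y" for x y
  proof (rule field_le_epsilon)
    fix e :: real
    assume "0 < e"
    then obtain xs ys where xs: "xs \<in> P x" "w xs < N x + e/2" and ys: "ys \<in> P y" "w ys < N y + e/2"
      using approx[of x "N x + e/2"] approx[of y "N y + e/2"] by auto
    have "xs @ ys \<in> P (x + y)"
      using xs ys by (auto simp: P_def)
    from N_le[OF this] show "N (x + y) \<le> N x + N y + e"
      using xs ys by (simp add: w_def)
  qed
  have N_minus_le: "N (- x) \<le> N x" for x
  proof (rule field_le_epsilon)
    fix e :: real
    assume "0 < e"
    then obtain xs where xs: "xs \<in> P x" "w xs < N x + e"
      using approx[of x "N x + e"] by auto
    \<comment> \<open>Addition need not commute, so negating a sum also reverses the order of its
      terms.\<close>
    let ?ys = "rev (map (\<lambda>p. (fst p, - snd p)) xs)"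
    have "(\<Sum>p\<leftarrow>?ys. snd p) = - (\<Sum>p\<leftarrow>xs. snd p)"
      by (induction xs) (auto simp: minus_add)
    then have "?ys \<in> P (- x)"
      using xs minus by (auto simp: P_def)
    moreover have "w ?ys = w xs"
      by (induction xs) (auto simp: w_def)
    ultimately show "N (- x) \<le> N x + e"
      using N_le[of ?ys "- x"] xs by simp
  qed
  have N_minus: "N (- x) = N x" for x
    using N_minus_le[of x] N_minus_le[of "- x"] by simp
  have N_W: "N x \<le> (1/2) ^ n" if "x \<in> W n" for x n
    using N_le[of "[(n, x)]" x] that by (simp add: P_def w_def)
  \<comment> \<open>Subadditivity and symmetry bound \<open>|N x - N a|\<close> by
    \<open>N (- a + x)\<close>, which is at most \<open>(1/2) ^ n\<close> on the translate of
    \<open>W n\<close> by \<open>a\<close>.\<close>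
  have "(N \<longlongrightarrow> N a) (at a)" for a
  proof (rule tendstoI)
    fix e :: real
    assume "0 < e"
    then obtain n where n: "(1/2 :: real) ^ n < e"
      using real_arch_pow_inv[of e "1/2"] by auto
    have "open ((\<lambda>x. - a + x) -` W n)"
      by (intro open_vimage open_W continuous_intros)
    moreover have "a \<in> (\<lambda>x. - a + x) -` W n"
      using zero by simp
    moreover have "dist (N x) (N a) < e" if "x \<in> (\<lambda>x. - a + x) -` W n" for x
    proof -
      have "N x \<le> N a + N (- a + x)"
        using N_add[of a "- a + x"] by (simp add: add.assoc[symmetric])
      moreover have "N a \<le> N x + N (- (- a + x))"
        using N_add[of x "- x + a"] by (simp add: add.assoc[symmetric] minus_add)
      moreover have "N (- a + x) < e"
        using N_W[of "- a + x" n] that n by simp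
      ultimately show ?thesis
        using N_minus[of "- a + x"] by (simp add: dist_real_def abs_less_iff)
    qed
    ultimately show "\<forall>\<^sub>F x in at a. dist (N x) (N a) < e"
      unfolding eventually_at_topological by blast
  qed
  then have "cont_pseudonorm N"
    using N_zero N_add N_minus by (simp add: cont_pseudonorm_def continuous_on_def)
  moreover have "\<exists>e>0. {x. N x < e} \<subseteq> V n" for n
    using mem_W[of _ "Suc (Suc n)"] W_V[of n]
    by (intro exI[of _ "(1/2) ^ Suc (Suc n)"]) auto
  ultimately show thesis
    using that by blast
qed

lemma cont_pseudonorm_exists_single:
  fixes V :: "'a::topological_group_add set"
  assumes "open V" "0 \<in> V"
  obtains N e where "cont_pseudonorm N" "e > 0" "{x. N x < e} \<subseteq> V"
  using cont_pseudonorm_exists[of "\<lambda>_. V"] assms by (metis interior_open)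

section \<open>Pseudocompact groups\<close>

text \<open>Each \<open>F n\<close> carries a bump function of height 1, built from a pseudonorm
  translated to a point of \<open>F n\<close>. Local finiteness makes the sum of \<open>n\<close>
  times the \<open>n\<close>-th bump continuous, yet it is unbounded.\<close>

lemma pseudocompact_not_locally_finite:
  fixes F :: "nat \<Rightarrow> 'a::topological_group_add set"
  assumes pc: "pseudocompact_space (euclidean :: 'a topology)"
    and "\<And>n. open (F n)" "\<And>n. F n \<noteq> {}"
    and lf: "\<And>y. \<exists>U. open U \<and> y \<in> U \<and> finite {n. F n \<inter> U \<noteq> {}}"
  shows False
proof -
  obtain x where x: "x n \<in> F n" for n
    using choice[of "\<lambda>n y. y \<in> F n"] assms(3) by (auto simp: ex_in_conv)
  have "\<exists>M e. cont_pseudonorm M \<and> 0 < e \<and> {y. M y < e} \<subseteq> (\<lambda>y. x n + y) -` F n" for n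
  proof -
    have "open ((\<lambda>y. x n + y) -` F n)"
      by (intro open_vimage assms(2) continuous_intros)
    moreover have "0 \<in> (\<lambda>y. x n + y) -` F n"
      using x by simp
    ultimately show ?thesis
      using cont_pseudonorm_exists_single by metis
  qed
  then obtain M e where M: "\<And>n. cont_pseudonorm (M n)" and e: "\<And>n. 0 < e n"
    and MF: "\<And>n. {y. M n y < e n} \<subseteq> (\<lambda>y. x n + y) -` F n"
    by metis
  define f where "f n y = max 0 (1 - M n (- x n + y) / e n)" for n y
  have f_eq_0: "f n y = 0" if "y \<notin> F n" for n y
  proof -
    have "x n + (- x n + y) = y"
      by (simp add: add.assoc[symmetric])
    then have "\<not> M n (- x n + y) < e n"
      using MF[of n] that by (metis (mono_tags, lifting) mem_Collect_eq subsetD vimage_eq)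
    then show ?thesis
      using e[of n] by (simp add: f_def)
  qed
  have f_nonneg: "0 \<le> f n y" for n y
    by (simp add: f_def)
  have f_x: "f n (x n) = 1" for n
    using cont_pseudonormD(1)[OF M] by (simp add: f_def)
  have f_cont: "continuous_on U (f n)" for n U
    unfolding f_def using e[of n]
    by (intro continuous_intros continuous_on_subset[OF continuous_on_pseudonorm_diff[OF M]]) auto
  have fin: "finite {n. y \<in> F n}" for y
  proof -
    obtain U where "y \<in> U" "finite {n. F n \<inter> U \<noteq> {}}"
      using lf by blast
    then show ?thesis
      by (auto elim: rev_finite_subset)
  qed
  define g where "g y = (\<Sum>n | y \<in> F n. real n * f n y)" for y
  have "(g \<longlongrightarrow> g y) (at y)" for y
  proof -
    obtain U where U: "open U" "y \<in> U" and finU: "finite {n. F n \<inter> U \<noteq> {}}"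
      using lf by blast
    \<comment> \<open>The index set can be fixed throughout \<open>U\<close>, since
      \<open>f n\<close> vanishes off \<open>F n\<close>; so \<open>g\<close> is locally a finite
      sum of continuous functions.\<close>
    have "g z = (\<Sum>n | F n \<inter> U \<noteq> {}. real n * f n z)" if "z \<in> U" for z
      unfolding g_def using that finU f_eq_0 by (intro sum.mono_neutral_left) auto
    moreover have "continuous_on U (\<lambda>z. \<Sum>n | F n \<inter> U \<noteq> {}. real n * f n z)"
      by (intro continuous_intros f_cont)
    ultimately have "continuous_on U g"
      by (simp cong: continuous_on_cong)
    then show ?thesis
      using U at_within_open[of y U] by (auto simp: continuous_on_def)
  qed
  then have "bounded (range g)"
    using pc by (simp add: pseudocompact_space_def continuous_on_def)
  then obtain B where B: "\<And>y. \<bar>g y\<bar> \<le> B"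
    by (auto simp: bounded_iff)
  obtain n where n: "B < real n"
    using reals_Archimedean2 by blast
  have "real n * f n (x n) \<le> g (x n)"
    unfolding g_def using x fin f_nonneg by (intro member_le_sum) auto
  then show False
    using B[of "x n"] n f_x[of n] by simp
qed

section \<open>Domination and total boundedness\<close>

text \<open>Otherwise the open sets \<open>{N < 1/(n+1), M > e/2}\<close> would all be nonempty, yet
  they are locally finite. If \<open>N y = 0\<close>, then \<open>M y = 0\<close> and the
  neighbourhood \<open>{M < e/2}\<close> of \<open>y\<close> meets none of them; if
  \<open>N y > 0\<close>, then \<open>{N > N y / 2}\<close> meets only finitely many.\<close>

lemma pseudocompact_pseudonorm_dominated:
  fixes N M :: "'a::topological_group_add \<Rightarrow> real"
  assumes pc: "pseudocompact_space (euclidean :: 'a topology)"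
    and N: "cont_pseudonorm N" and M: "cont_pseudonorm M"
    and zero: "\<And>x. N x = 0 \<Longrightarrow> M x = 0" and "0 < e"
  obtains d where "0 < d" "\<And>x. N x < d \<Longrightarrow> M x < e"
proof -
  have "\<exists>d>0. \<forall>x. N x < d \<longrightarrow> M x < e"
  proof (rule ccontr)
    assume contr: "\<nexists>d. 0 < d \<and> (\<forall>x. N x < d \<longrightarrow> M x < e)"
    define F where "F n = {x. N x < inverse (real (Suc n))} \<inter> {x. e / 2 < M x}" for n
    show False
    proof (rule pseudocompact_not_locally_finite[OF pc])
      show "open (F n)" for n
        unfolding F_def by (intro open_Int open_pseudonorm_less open_pseudonorm_greater N M)
      show "F n \<noteq> {}" for n
      proof -
        obtain x where "N x < inverse (real (Suc n))" "\<not> M x < e"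
          using contr by (metis inverse_positive_iff_positive of_nat_0_less_iff zero_less_Suc)
        then have "x \<in> F n"
          using \<open>0 < e\<close> by (simp add: F_def)
        then show ?thesis
          by blast
      qed
      show "\<exists>U. open U \<and> y \<in> U \<and> finite {n. F n \<inter> U \<noteq> {}}" for y
      proof (cases "N y = 0")
        case True
        then have "{n. F n \<inter> {x. M x < e / 2} \<noteq> {}} = {}"
          by (auto simp: F_def)
        then show ?thesis
          using open_pseudonorm_less[OF M, of "e / 2"] zero[OF True] \<open>0 < e\<close>
          by (intro exI[of _ "{x. M x < e / 2}"]) simp
      next
        case False
        then have pos: "0 < N y / 2"
          using cont_pseudonormD(5)[OF N, of y] by simp
        then obtain k where k: "inverse (real (Suc k)) < N y / 2"
          using reals_Archimedean by blast
        have "n \<le> k" if "F n \<inter> {x. N y / 2 < N x} \<noteq> {}" for n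
        proof (rule ccontr)
          assume "\<not> n \<le> k"
          then have "inverse (real (Suc n)) \<le> inverse (real (Suc k))"
            by (intro le_imp_inverse_le) auto
          moreover obtain x where "N x < inverse (real (Suc n))" "N y / 2 < N x"
            using \<open>F n \<inter> {x. N y / 2 < N x} \<noteq> {}\<close> by (auto simp: F_def)
          ultimately show False
            using k by linarith
        qed
        then have "finite {n. F n \<inter> {x. N y / 2 < N x} \<noteq> {}}"
          by (intro finite_subset[OF _ finite_atMost[of k]]) auto
        then show ?thesis
          using open_pseudonorm_greater[OF N, of "N y / 2"] pos
          by (intro exI[of _ "{x. N y / 2 < N x}"]) simp
      qed
    qed
  qed
  then show thesis
    using that by blast
qed

text \<open>Without a finite net, a greedy choice yields an infinite \<open>e\<close>-separated
  sequence, whose balls of radius \<open>e/4\<close> form a locally finite family.\<close>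

lemma pseudocompact_finite_net:
  fixes N :: "'a::topological_group_add \<Rightarrow> real"
  assumes pc: "pseudocompact_space (euclidean :: 'a topology)"
    and N: "cont_pseudonorm N" and "0 < e"
  shows "\<exists>D. finite D \<and> (\<forall>x. \<exists>y\<in>D. N (- y + x) < e)"
proof (rule ccontr)
  assume contr: "\<nexists>D. finite D \<and> (\<forall>x. \<exists>y\<in>D. N (- y + x) < e)"
  have "\<exists>x :: nat \<Rightarrow> 'a. \<forall>n. \<forall>m<n. e \<le> N (- x m + x n)"
  proof (rule dependent_wellorder_choice)
    fix n :: nat and x :: "nat \<Rightarrow> 'a"
    have "finite (x ` {..<n})"
      by simp
    then obtain z where "\<forall>y\<in>x ` {..<n}. \<not> N (- y + z) < e"
      using contr by blast
    then show "\<exists>z. \<forall>m<n. e \<le> N (- x m + z)"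
      by (intro exI[of _ z]) (auto simp: not_less)
  qed auto
  then obtain x :: "nat \<Rightarrow> 'a" where "\<forall>n. \<forall>m<n. e \<le> N (- x m + x n)"
    by (rule exE)
  then have sep: "e \<le> N (- x m + x n)" if "m < n" for m n
    using that by simp
  have sep': "m = n" if "N (- x m + x n) < e" for m n
    using sep[of m n] sep[of n m] that cont_pseudonorm_commute[OF N, of "x m" "x n"]
    by (cases m n rule: linorder_cases) auto
  \<comment> \<open>If a ball of radius \<open>e/4\<close> around \<open>y\<close> meets both
    \<open>F m\<close> and \<open>F n\<close>, their centres are within \<open>e/2\<close> of
    \<open>y\<close>, hence less than \<open>e\<close> apart, and \<open>m = n\<close>.\<close>
  define F where "F n = {z. N (- x n + z) < e / 4}" for n
  show False
  proof (rule pseudocompact_not_locally_finite[OF pc])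
    show "open (F n)" for n
      unfolding F_def by (rule open_pseudonorm_ball[OF N])
    show "F n \<noteq> {}" for n
      using cont_pseudonormD(1)[OF N] \<open>0 < e\<close> by (auto simp: F_def intro!: exI[of _ "x n"])
    show "\<exists>U. open U \<and> y \<in> U \<and> finite {n. F n \<inter> U \<noteq> {}}" for y
    proof (intro exI conjI)
      let ?U = "{z. N (- y + z) < e / 4}"
      show "open ?U"
        by (rule open_pseudonorm_ball[OF N])
      show "y \<in> ?U"
        using cont_pseudonormD(1)[OF N] \<open>0 < e\<close> by simp
      have near: "N (- x n + y) < e / 2" if meets: "F n \<inter> ?U \<noteq> {}" for n
      proof -
        obtain z where "z \<in> F n" "z \<in> ?U"
          using meets by blast
        then have "N (- x n + z) < e / 4" "N (- y + z) < e / 4"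
          by (simp_all add: F_def)
        then show ?thesis
          using cont_pseudonorm_triangle[OF N, of "x n" y z] cont_pseudonorm_commute[OF N, of y z]
          by simp
      qed
      have "m = n" if "F m \<inter> ?U \<noteq> {}" "F n \<inter> ?U \<noteq> {}" for m n
        using near[OF that(1)] near[OF that(2)] cont_pseudonorm_triangle[OF N, of "x m" "x n" y]
          cont_pseudonorm_commute[OF N, of y "x n"] by (intro sep') simp
      then have "is_singleton {n. F n \<inter> ?U \<noteq> {}} \<or> {n. F n \<inter> ?U \<noteq> {}} = {}"
        by (metis (mono_tags, lifting) is_singletonI' mem_Collect_eq)
      then show "finite {n. F n \<inter> ?U \<noteq> {}}"
        by (metis finite.emptyI finite_insert is_singleton_def)
    qed
  qed
qed

lemma pseudocompact_separable:
  fixes N :: "'a::topological_group_add \<Rightarrow> real"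
  assumes pc: "pseudocompact_space (euclidean :: 'a topology)"
    and N: "cont_pseudonorm N"
  obtains D where "countable D" "\<And>x e. 0 < e \<Longrightarrow> \<exists>y\<in>D. N (- y + x) < e"
proof -
  have "\<forall>n. \<exists>D. finite D \<and> (\<forall>x. \<exists>y\<in>D. N (- y + x) < inverse (real (Suc n)))"
    using pseudocompact_finite_net[OF pc N] by simp
  then obtain D where D: "\<And>n. finite (D n)"
    "\<And>n x. \<exists>y\<in>D n. N (- y + x) < inverse (real (Suc n))"
    by metis
  show thesis
  proof
    show "countable (\<Union>n. D n)"
      using D(1) by (simp add: countable_finite)
    show "\<exists>y\<in>(\<Union>n. D n). N (- y + x) < e" if "0 < e" for x e
      using reals_Archimedean[OF that] D(2) by (meson UNIV_I UN_I less_trans)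
  qed
qed

section \<open>Metrizability and countable families of pseudonorms\<close>

text \<open>Balls of \<open>N\<close> are open by continuity. Conversely, an identity neighbourhood
  contains a ball of some pseudonorm \<open>M\<close>; as \<open>N\<close> vanishes only at 0, where
  \<open>M\<close> does too, domination fits a ball of \<open>N\<close> inside.\<close>

lemma pseudocompact_metrizable_of_pseudonorm:
  fixes N :: "'a::topological_group_add \<Rightarrow> real"
  assumes pc: "pseudocompact_space (euclidean :: 'a topology)"
    and N: "cont_pseudonorm N" and inj: "\<And>x. N x = 0 \<Longrightarrow> x = 0"
  shows "metrizable_space (euclidean :: 'a topology)"
proof -
  interpret Metric_space UNIV "\<lambda>x y. N (- x + y)"
  proof
    fix x y z :: 'a
    show "0 \<le> N (- x + y)"
      by (rule cont_pseudonormD(5)[OF N])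
    show "N (- x + y) = N (- y + x)"
      by (rule cont_pseudonorm_commute[OF N])
    show "N (- x + y) = 0 \<longleftrightarrow> x = y"
      using inj[of "- x + y"] cont_pseudonormD(1)[OF N] neg_eq_iff_add_eq_0[of "- x" y] by auto
    show "N (- x + z) \<le> N (- x + y) + N (- y + z)"
      by (rule cont_pseudonorm_triangle[OF N])
  qed
  have mball: "mball x r = {z. N (- x + z) < r}" for x r
    by (auto simp: in_mball)
  have "openin mtopology U \<longleftrightarrow> open U" for U
  proof
    assume U: "openin mtopology U"
    show "open U"
    proof (subst open_subopen, rule ballI)
      fix x
      assume "x \<in> U"
      then obtain r where r: "r > 0" "mball x r \<subseteq> U"
        using U by (auto simp: openin_mtopology)
      moreover have "open (mball x r)"
        unfolding mball by (rule open_pseudonorm_ball[OF N])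
      ultimately show "\<exists>T. open T \<and> x \<in> T \<and> T \<subseteq> U"
        by (intro exI[of _ "mball x r"]) (auto simp: cont_pseudonormD(1)[OF N])
    qed
  next
    assume U: "open U"
    have "\<exists>r>0. mball x r \<subseteq> U" if "x \<in> U" for x
    proof -
      have "open ((\<lambda>y. x + y) -` U)"
        by (intro open_vimage U continuous_intros)
      moreover have "0 \<in> (\<lambda>y. x + y) -` U"
        using that by simp
      ultimately obtain M e where M: "cont_pseudonorm M" "e > 0"
        and MU: "{y. M y < e} \<subseteq> (\<lambda>y. x + y) -` U"
        by (rule cont_pseudonorm_exists_single)
      have "M y = 0" if "N y = 0" for y
        using inj[OF that] cont_pseudonormD(1)[OF M(1)] by simp
      from pseudocompact_pseudonorm_dominated[OF pc N M(1) this M(2)]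
      obtain d where d: "0 < d" "\<And>y. N y < d \<Longrightarrow> M y < e"
        by metis
      have "mball x d \<subseteq> U"
      proof
        fix z
        assume "z \<in> mball x d"
        then have "M (- x + z) < e"
          using d(2) by (simp add: mball)
        then have "- x + z \<in> (\<lambda>y. x + y) -` U"
          using MU by blast
        then show "z \<in> U"
          by (simp add: add.assoc[symmetric])
      qed
      then show ?thesis
        using d(1) by blast
    qed
    then show "openin mtopology U"
      by (simp add: openin_mtopology)
  qed
  then have "mtopology = euclidean"
    by (simp add: topology_eq)
  then show ?thesis
    using metrizable_space_mtopology by simp
qed

text \<open>The countably many neighbourhoods \<open>{f < 1/(n+1)}\<close> feed the
  Birkhoff-Kakutani construction; a zero of \<open>N\<close> lies in all of them.\<close>

lemma cont_pseudonorm_countable_common_zero: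
  fixes \<F> :: "('a::topological_group_add \<Rightarrow> real) set"
  assumes "countable \<F>" "\<And>f. f \<in> \<F> \<Longrightarrow> cont_pseudonorm f"
  obtains N where "cont_pseudonorm N" "\<And>f x. f \<in> \<F> \<Longrightarrow> N x = 0 \<Longrightarrow> f x = 0"
proof -
  \<comment> \<open>The zero pseudonorm keeps the index set nonempty when \<open>\<F>\<close> is
    empty, so that \<open>from_nat_into\<close> enumerates exactly \<open>\<G>\<close>.\<close>
  define \<G> where "\<G> = insert (\<lambda>_. 0) \<F> \<times> (UNIV :: nat set)"
  define p where "p = from_nat_into \<G>"
  have "cont_pseudonorm (\<lambda>_ :: 'a. 0)"
    by (simp add: cont_pseudonorm_def)
  then have \<G>: "cont_pseudonorm (fst q)" if "q \<in> \<G>" for q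
    using that assms(2) by (auto simp: \<G>_def)
  have range_p: "range p = \<G>"
    unfolding p_def using assms(1) by (intro range_from_nat_into) (auto simp: \<G>_def)
  define V where "V k = {x. fst (p k) x < inverse (real (Suc (snd (p k))))}" for k
  have "0 \<in> interior (V k)" for k
  proof -
    have "cont_pseudonorm (fst (p k))"
      using \<G> range_p by blast
    then show ?thesis
      unfolding V_def by (simp add: interior_open[OF open_pseudonorm_less] cont_pseudonormD(1))
  qed
  then obtain N where N: "cont_pseudonorm N" "\<And>k. \<exists>e>0. {x. N x < e} \<subseteq> V k"
    by (rule cont_pseudonorm_exists[of V]) blast
  show thesis
  proof
    show "cont_pseudonorm N"
      by (rule N(1))
    fix f x
    assume f: "f \<in> \<F>" and x: "N x = 0"
    have "f x < inverse (real (Suc n))" for n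
    proof -
      have "(f, n) \<in> range p"
        using f range_p by (simp add: \<G>_def)
      then obtain k where k: "p k = (f, n)"
        by (metis imageE)
      have "x \<in> V k"
        using N(2)[of k] x by auto
      then show ?thesis
        by (simp add: V_def k)
    qed
    then have "\<not> 0 < f x"
      using reals_Archimedean less_asym by blast
    then show "f x = 0"
      using cont_pseudonormD(5)[OF assms(2)[OF f], of x] by simp
  qed
qed

section \<open>The transfinite sequence\<close>

text \<open>This is the ordinal omega_1, as the successor cardinal of aleph_0; being a well-order,
  it also carries the recursion.\<close>

abbreviation \<Omega> :: "nat set rel" where
  "\<Omega> \<equiv> cardSuc natLeq"

lemma Card_order_\<Omega>: "Card_order \<Omega>"
  by (simp add: cardSuc_Card_order natLeq_Card_order)

text \<open>A proper initial segment of a cardinal order is strictly smaller than the whole, and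
  smaller than aleph_1 means countable. An index outside the field has no predecessors.\<close>

lemma countable_underS_\<Omega>:
  includes cardinal_syntax
  shows "countable (underS \<Omega> i)"
proof (cases "i \<in> Field \<Omega>")
  case True
  then have "|underS \<Omega> i| <o \<Omega>"
    by (rule card_of_underS[OF Card_order_\<Omega>])
  then have "|underS \<Omega> i| \<le>o natLeq"
    by (simp add: cardSuc_ordLeq_ordLess natLeq_Card_order card_of_Card_order)
  then show ?thesis
    by (simp add: countable_card_le_natLeq)
next
  case False
  then show ?thesis
    using underS_empty[of i \<Omega>] by simp
qed

lemma uncountable_Field_\<Omega>:
  includes cardinal_syntax
  shows "uncountable (Field \<Omega>)"
proof -
  have "natLeq <o |Field \<Omega>|"
    using cardSuc_greater[OF natLeq_Card_order] card_of_Field_ordIso[OF Card_order_\<Omega>]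
    by (meson ordIso_symmetric ordLess_ordIso_trans)
  then show ?thesis
    by (simp add: countable_card_le_natLeq not_ordLeq_iff_ordLess natLeq_Well_order
        card_of_Well_order)
qed

text \<open>Every uncountable cardinal is at least aleph_1. The surjection lets a family indexed by
  omega_1 be reindexed by the field of \<open>\<tau>\<close>.\<close>

lemma Field_\<Omega>_image:
  includes cardinal_syntax
  assumes "uncountable A"
  obtains h where "h ` A = Field \<Omega>"
proof -
  have "natLeq <o |A|"
    using assms
    by (simp add: countable_card_le_natLeq not_ordLeq_iff_ordLess natLeq_Well_order
        card_of_Well_order)
  then have "\<Omega> \<le>o |A|"
    by (simp add: cardSuc_least natLeq_Card_order card_of_Card_order)
  then have "|Field \<Omega>| \<le>o |A|"
    using card_of_Field_ordIso[OF Card_order_\<Omega>] ordIso_ordLeq_trans by blast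
  moreover have "Field \<Omega> \<noteq> {}"
    using uncountable_Field_\<Omega> by auto
  ultimately show thesis
    using that by (metis card_of_ordLeq2)
qed

section \<open>Recursion along omega_1 and the contradiction\<close>

text \<open>At stage \<open>i\<close> the countably many earlier pseudonorms all vanish on the zero
  set of one \<open>N\<close>. Nonmetrizability puts some \<open>z \<noteq> 0\<close> into that zero
  set, and the Hausdorff property supplies a new pseudonorm that is nonzero at
  \<open>z\<close>.\<close>

lemma nonmetrizable_transfinite_sequence:
  assumes pc: "pseudocompact_space (euclidean :: 'a::{topological_group_add, t2_space} topology)"
    and nm: "\<not> metrizable_space (euclidean :: 'a topology)"
  obtains f :: "nat set \<Rightarrow> 'a::{topological_group_add, t2_space} \<Rightarrow> real" and z
  where "\<And>i. cont_pseudonorm (f i)"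
    "\<And>i. f i (z i) \<noteq> 0" "\<And>i j. j \<in> underS \<Omega> i \<Longrightarrow> f j (z i) = 0"
proof -
  let ?P = "\<lambda>f i M. cont_pseudonorm M \<and> (\<exists>z :: 'a. (\<forall>j\<in>underS \<Omega> i. f j z = (0 :: real)) \<and> M z \<noteq> 0)"
  have "\<exists>f. \<forall>i. ?P f i (f i)"
  proof (rule dependent_wf_choice)
    show "wf (\<Omega> - Id)"
      using Card_order_\<Omega> by (simp add: card_order_on_def well_order_on_def)
    show "?P f i M = ?P g i M" if "\<And>j. (j, i) \<in> \<Omega> - Id \<Longrightarrow> f j = g j" for f g i M
      using that by (simp add: underS_def)
    fix i and f :: "nat set \<Rightarrow> 'a \<Rightarrow> real"
    assume IH: "\<And>j. (j, i) \<in> \<Omega> - Id \<Longrightarrow> ?P f j (f j)"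
    have "countable (f ` underS \<Omega> i)"
      by (simp add: countable_underS_\<Omega>)
    moreover have "cont_pseudonorm g" if "g \<in> f ` underS \<Omega> i" for g
      using IH that by (auto simp: underS_def)
    ultimately obtain N where N: "cont_pseudonorm N"
      "\<And>g x. g \<in> f ` underS \<Omega> i \<Longrightarrow> N x = 0 \<Longrightarrow> g x = 0"
      using cont_pseudonorm_countable_common_zero by metis
    obtain z where z: "N z = 0" "z \<noteq> 0"
      using pseudocompact_metrizable_of_pseudonorm[OF pc N(1)] nm by blast
    then obtain V where V: "open V" "0 \<in> V" "z \<notin> V"
      by (metis t1_space)
    obtain M e where M: "cont_pseudonorm M" "0 < e" "{x. M x < e} \<subseteq> V"
      using cont_pseudonorm_exists_single[OF V(1,2)] by metis
    have "M z \<noteq> 0"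
      using M(2,3) V(3) by (metis mem_Collect_eq subsetD)
    then show "\<exists>M. ?P f i M"
      using M(1) N(2) z(1) by blast
  qed
  then obtain f where "\<And>i. ?P f i (f i)"
    by (elim exE) blast
  then show thesis
    using that by metis
qed

text \<open>If all \<open>f i\<close> were continuous for a single pseudonorm \<open>N\<close>, the sets \<open>{f i \<noteq> 0}\<close> would be
  \<open>N\<close>-open with \<open>z i\<close> in the \<open>i\<close>-th but in none of the earlier ones, which separability excludes.\<close>
lemma pseudocompact_no_common_bound:
  fixes f :: "nat set \<Rightarrow> 'a::topological_group_add \<Rightarrow> real"
  assumes pc: "pseudocompact_space (euclidean :: 'a topology)"
    and f: "\<And>i. cont_pseudonorm (f i)"
    and z: "\<And>i. f i (z i) \<noteq> 0" "\<And>i j. j \<in> underS \<Omega> i \<Longrightarrow> f j (z i) = 0"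
    and N: "cont_pseudonorm N" and zero: "\<And>i x. i \<in> Field \<Omega> \<Longrightarrow> N x = 0 \<Longrightarrow> f i x = 0"
  shows False
proof -
  obtain D where D: "countable D" "\<And>x e. 0 < e \<Longrightarrow> \<exists>y\<in>D. N (- y + x) < e"
    using pseudocompact_separable[OF pc N] by metis
  \<comment> \<open>Each \<open>i\<close> gets a label \<open>(y, n)\<close> from a countable set.
    The radius is doubled because two points near the same \<open>y\<close> are only within twice
    the radius of each other.\<close>
  have "\<exists>y n. y \<in> D \<and> N (- y + z i) < inverse (real (Suc n)) \<and>
      (\<forall>x. N x < 2 * inverse (real (Suc n)) \<longrightarrow> f i x < f i (z i))" if i: "i \<in> Field \<Omega>" for i
  proof -
    have "0 < f i (z i)"
      using z(1)[of i] cont_pseudonormD(5)[OF f, of i "z i"] by simp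
    then obtain d where d: "0 < d" "\<And>x. N x < d \<Longrightarrow> f i x < f i (z i)"
      using pseudocompact_pseudonorm_dominated[OF pc N f zero[OF i]] by metis
    obtain n where n: "inverse (real (Suc n)) < d / 2"
      using reals_Archimedean[of "d / 2"] d(1) by auto
    obtain y where "y \<in> D" "N (- y + z i) < inverse (real (Suc n))"
      using D(2)[of "inverse (real (Suc n))"] by auto
    moreover have "f i x < f i (z i)" if "N x < 2 * inverse (real (Suc n))" for x
      using that n by (intro d(2)) simp
    ultimately show ?thesis
      by blast
  qed
  then obtain y n where y: "\<And>i. i \<in> Field \<Omega> \<Longrightarrow> y i \<in> D"
    and near: "\<And>i. i \<in> Field \<Omega> \<Longrightarrow> N (- y i + z i) < inverse (real (Suc (n i)))"
    and small: "\<And>i x. i \<in> Field \<Omega> \<Longrightarrow> N x < 2 * inverse (real (Suc (n i))) \<Longrightarrow> f i x < f i (z i)"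
    by metis
  \<comment> \<open>If \<open>i\<close> precedes \<open>j\<close> and has the same label, then
    \<open>- z j + z i\<close> is small for \<open>N\<close>. Since \<open>f i (z j) = 0\<close>,
    this gives \<open>f i (z i) \<le> f i (- z j + z i) < f i (z i)\<close>.\<close>
  have no_clash: False
    if "i \<in> Field \<Omega>" "j \<in> Field \<Omega>" "y i = y j" "n i = n j" "i \<in> underS \<Omega> j" for i j
  proof -
    have "N (- z j + z i) < 2 * inverse (real (Suc (n i)))"
      using near[OF that(1)] near[OF that(2)] that(3,4) cont_pseudonorm_triangle[OF N, of "z j" "z i" "y i"]
        cont_pseudonorm_commute[OF N, of "z j" "y i"] by simp
    then have "f i (- z j + z i) < f i (z i)"
      by (rule small[OF that(1)])
    then show False
      using cont_pseudonorm_le_add[OF f, of i "z i" "z j"] z(2)[OF that(5)] by simp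
  qed
  have "inj_on (\<lambda>i. (y i, n i)) (Field \<Omega>)"
  proof (rule inj_onI)
    fix i j
    assume ij: "i \<in> Field \<Omega>" "j \<in> Field \<Omega>" and eq: "(y i, n i) = (y j, n j)"
    have "total_on (Field \<Omega>) \<Omega>"
      using Card_order_\<Omega> by (simp add: card_order_on_def well_order_on_def linear_order_on_def)
    then have "i = j \<or> i \<in> underS \<Omega> j \<or> j \<in> underS \<Omega> i"
      using ij by (auto simp: total_on_def underS_def)
    then show "i = j"
      using no_clash[of i j] no_clash[of j i] ij eq by auto
  qed
  moreover have "countable ((\<lambda>i. (y i, n i)) ` Field \<Omega>)"
    by (rule countable_subset[of _ "D \<times> UNIV"]) (use y D(1) in auto)
  ultimately show False
    using uncountable_Field_\<Omega> countable_image_inj_on by blast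
qed

theorem theorem2p11:
  fixes \<tau> :: "'i rel"
  assumes "Card_order \<tau>"
    and "uncountable (Field \<tau>)"
    and "pseudocompact_space (euclidean :: 'a::{topological_group_add, t2_space} topology)"
    and "\<not> metrizable_space (euclidean :: 'a topology)"
  shows "\<not> pseudo_fine \<tau> TYPE('a)"
proof
  assume fine: "pseudo_fine \<tau> TYPE('a)"
  obtain f :: "nat set \<Rightarrow> 'a \<Rightarrow> real" and z where f: "\<And>i. cont_pseudonorm (f i)"
    and z: "\<And>i. f i (z i) \<noteq> 0" "\<And>i j. j \<in> underS \<Omega> i \<Longrightarrow> f j (z i) = 0"
    using nonmetrizable_transfinite_sequence[OF assms(3,4)] by metis
  obtain h where h: "h ` Field \<tau> = Field \<Omega>"
    using Field_\<Omega>_image[OF assms(2)] by metis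
  \<comment> \<open>Pseudo-fineness is applied once for each \<open>n\<close>, to the sequence
    pulled back along \<open>h\<close>, so the family stays indexed by \<open>\<tau>\<close>
    alone.\<close>
  have "\<exists>V :: nat \<Rightarrow> 'a set. (\<forall>k. 0 \<in> interior (V k)) \<and>
      (\<Inter>k. V k) \<subseteq> (\<Inter>\<alpha>\<in>Field \<tau>. {x. f (h \<alpha>) x < inverse (real (Suc n))})" for n
  proof -
    have "0 \<in> interior {x. f i x < inverse (real (Suc n))}" for i
      by (simp add: interior_open[OF open_pseudonorm_less[OF f]] cont_pseudonormD(1)[OF f])
    then show ?thesis
      using fine unfolding pseudo_fine_def by simp
  qed
  then obtain V :: "nat \<Rightarrow> nat \<Rightarrow> 'a set" where V: "\<And>n k. 0 \<in> interior (V n k)"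
    and Vsub: "\<And>n. (\<Inter>k. V n k) \<subseteq> (\<Inter>\<alpha>\<in>Field \<tau>. {x. f (h \<alpha>) x < inverse (real (Suc n))})"
    by metis
  \<comment> \<open>Pairing turns the doubly indexed \<open>V n k\<close> into one sequence, so the
    zero set of a single \<open>N\<close> lies in all of them.\<close>
  obtain N where N: "cont_pseudonorm N"
    and NV: "\<And>m. \<exists>e>0. {x. N x < e} \<subseteq> case_prod V (prod_decode m)"
    by (rule cont_pseudonorm_exists[of "\<lambda>m. case_prod V (prod_decode m)"])
       (use V in \<open>auto split: prod.split\<close>)
  \<comment> \<open>Surjectivity of \<open>h\<close> reaches every \<open>i\<close> in the field,
    and \<open>f i x\<close> falls below every \<open>1/(n+1)\<close>.\<close>
  have "f i x = 0" if i: "i \<in> Field \<Omega>" and x: "N x = 0" for i x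
  proof -
    have "x \<in> V n k" for n k
      using NV[of "prod_encode (n, k)"] x by auto
    then have "f i x < inverse (real (Suc n))" for n
    proof -
      obtain \<alpha> where "\<alpha> \<in> Field \<tau>" "i = h \<alpha>"
        using i h by (metis imageE)
      moreover have "x \<in> (\<Inter>k. V n k)"
        using \<open>\<And>n k. x \<in> V n k\<close> by simp
      ultimately show ?thesis
        using Vsub[of n] by auto
    qed
    then have "\<not> 0 < f i x"
      using reals_Archimedean less_asym by blast
    then show ?thesis
      using cont_pseudonormD(5)[OF f, of i x] by simp
  qed
  then show False
    using pseudocompact_no_common_bound[where f = f and z = z, OF assms(3) f z N] by blast
qed

end
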